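(* Let $\Delta$ be endowed with a $\sigma$-algebra and a probability measure $\mathbb{P}$, let $n:\Delta\to\mathbb{N}$ be the iteration-count function, let $N\ge 1$ be an integer, $\rho>0$, and let $x_1,\dots,x_N$ be i.i.d. samples from $\Delta$ drawn according to $\mathbb{P}$. Consider the relaxed scenario optimization problem $$\min_{y\ge 0,\ \xi_{N,i}\ge 0,\ i=1,\dots,N}\ \ y+\rho\sum_{i=1}^N \xi_{N,i}\qquad\text{subject to}\quad y+\xi_{N,i}\ge n(x_i),\quad i=1,\dots,N,$$ let $(y_N^*,\xi_{N,1}^*,\dots,\xi_{N,N}^* )$ be its optimal solution (unique, or singled out by the tie-break rule), and put $n_N^*(\rho):=y_N^*$, $q_N^*:=|\{i:\xi_{N,i}^*>0\}|$ and $s_N^*:=1+q_N^*$. For $y\ge 0$ let $V(y)=\mathbb{P}\{x\in\Delta: n(x)>y\}$. Fix $\beta\in(0,1)$. Then $$\mathbb{P}^N\bigl\{\{x_i\}_{i=1}^N:\ V(n_N^*(\rho))\le\epsilon(s_N^* )\bigr\}\ge 1-\beta,$$ where $\epsilon(q):=1-t(q)$ for $q=0,1,\dots,N-1$, with $t(q)$ the unique solution in $(0,1)$ of the polynomial equation $$\frac{\beta}{N}\sum_{m=q}^{N-1}\binom{m}{q}t^{m-q}-\binom{N}{q}t^{N-q}=0,$$ and $\epsilon(N):=1$ (with the convention $\epsilon(N+1):=1$).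
   Context: Setting. Consider a parametric optimization problem: minimize $f(z,x)$ over $z\in\mathbb{R}^n$ subject to $f_i(z,x)=0$ ($i=1,\dots,I$) and $g_j(z,x)\ge 0$ ($j=1,\dots,J$), with parameter $x\in\Delta\subset\mathbb{R}^d$, where $\Delta$ is the set of parameters for which the problem is feasible. An iterative algorithm produces iterates $z^k(x)$ converging to a (local) optimizer $z^*(x)$. For a fixed user-chosen tolerance $\eta$, $n(x)$ denotes the number of iterations the algorithm requires to solve the problem with parameter $x$ to within the tolerance, so that $\|z^{n(x)}(x)-z^*(x)\|\le\eta$. Thus $n$ is a (measurable) function on $\Delta$ taking nonnegative integer values (in a finite set); no assumption is made that its level sets have probability zero. Tie-break rule. The optimal value $y_N^*$ is assumed unique; otherwise it is singled out by a tie-break rule, i.e. a fixed ranking (total order) of the candidate values $y\ge 0$, the same for all samples and sample sizes, with $y_N^*$ the best-ranked among the optimal values of $y$ (assumed to exist). Given $y_N^*$, $\xi_{N,i}^*=\max\{0,n(x_i)-y_N^*\}$. $\mathbb{P}^N$ denotes the $N$-fold product measure on $\Delta^N$. $V(y)$ is the risk of $y$: the probability that a new parameter $x$ violates the constraint $y\ge n(x)$. *)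

theory Defs
  imports "HOL-Probability.Probability"
begin

text \<open>
  The relaxed scenario program with data \<open>a i\<close> (the value \<open>n (x\<^sub>i)\<close> at the \<open>i\<close>-th sample),
  \<open>i \<in> {1..N}\<close>.  The slack vector is a function on \<open>nat\<close>; its values outside \<open>{1..N}\<close> play
  no role.
\<close>

definition feasible :: "nat \<Rightarrow> (nat \<Rightarrow> real) \<Rightarrow> real \<Rightarrow> (nat \<Rightarrow> real) \<Rightarrow> bool" where
  "feasible N a y \<xi> \<longleftrightarrow> y \<ge> 0 \<and> (\<forall>i\<in>{1..N}. \<xi> i \<ge> 0 \<and> y + \<xi> i \<ge> a i)"

definition relaxed_cost :: "real \<Rightarrow> nat \<Rightarrow> real \<Rightarrow> (nat \<Rightarrow> real) \<Rightarrow> real" where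
  "relaxed_cost \<rho> N y \<xi> = y + \<rho> * (\<Sum>i=1..N. \<xi> i)"

definition optimal :: "real \<Rightarrow> nat \<Rightarrow> (nat \<Rightarrow> real) \<Rightarrow> real \<Rightarrow> (nat \<Rightarrow> real) \<Rightarrow> bool" where
  "optimal \<rho> N a y \<xi> \<longleftrightarrow> feasible N a y \<xi> \<and>
     (\<forall>y' \<xi>'. feasible N a y' \<xi>' \<longrightarrow> relaxed_cost \<rho> N y \<xi> \<le> relaxed_cost \<rho> N y' \<xi>')"

text \<open>
  The tie-break rule is a relation \<open>R\<close>, meant to be a total order on \<open>{0..}\<close>, where
  \<open>(y, y') \<in> R\<close> reads: \<open>y\<close> is ranked at least as high as \<open>y'\<close>.  If the optimal \<open>y\<close> is unique,
  the ranking is immaterial.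
\<close>

definition selected_solution ::
  "(real \<times> real) set \<Rightarrow> real \<Rightarrow> nat \<Rightarrow> (nat \<Rightarrow> real) \<Rightarrow> real \<Rightarrow> (nat \<Rightarrow> real) \<Rightarrow> bool" where
  "selected_solution R \<rho> N a y \<xi> \<longleftrightarrow> optimal \<rho> N a y \<xi> \<and>
     (\<forall>y' \<xi>'. optimal \<rho> N a y' \<xi>' \<longrightarrow> (y, y') \<in> R)"

definition risk :: "'a measure \<Rightarrow> ('a \<Rightarrow> nat) \<Rightarrow> real \<Rightarrow> real" where
  "risk M n y = measure M {x \<in> space M. real (n x) > y}"

definition eps_poly :: "real \<Rightarrow> nat \<Rightarrow> nat \<Rightarrow> real \<Rightarrow> real" where
  "eps_poly \<beta> N q t =
     \<beta> / real N * (\<Sum>m=q..N-1. real (m choose q) * t ^ (m - q))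
       - real (N choose q) * t ^ (N - q)"

definition eps_root :: "real \<Rightarrow> nat \<Rightarrow> nat \<Rightarrow> real" where
  "eps_root \<beta> N q = (THE t. 0 < t \<and> t < 1 \<and> eps_poly \<beta> N q t = 0)"

definition eps :: "real \<Rightarrow> nat \<Rightarrow> nat \<Rightarrow> real" where
  "eps \<beta> N q = (if q < N then 1 - eps_root \<beta> N q else 1)"

text \<open>The description in \<^const>\<open>eps_root\<close> is proper wherever \<^const>\<open>eps\<close> uses it.\<close>

lemma eps_poly_ex1:
  assumes "0 < \<beta>" "\<beta> < 1" "q < N"
  shows "\<exists>!t. 0 < t \<and> t < 1 \<and> eps_poly \<beta> N q t = 0"
proof (rule ex_ex1I)
  have "q \<le> N - 1" using assms by simp
  have p0: "eps_poly \<beta> N q 0 > 0"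
  proof -
    have "(\<Sum>m=q..N-1. real (m choose q) * 0 ^ (m - q)) = (\<Sum>m=q..N-1. if m = q then 1 else 0)"
      by (intro sum.cong) (auto simp: power_0_left)
    also have "\<dots> = 1" using \<open>q \<le> N - 1\<close> by simp
    finally show ?thesis using assms by (simp add: eps_poly_def power_0_left)
  qed
  have p1: "eps_poly \<beta> N q 1 < 0"
  proof -
    have s: "(\<Sum>m=q..N-1. m choose q) = N choose Suc q"
    proof -
      have "(\<Sum>m=q..N-1. m choose q) = (\<Sum>m=0..N-1. m choose q)"
        by (rule sum.mono_neutral_left) (auto simp: binomial_eq_0)
      also have "\<dots> = Suc (N - 1) choose Suc q" by (simp add: sum_choose_upper atLeast0AtMost)
      finally show ?thesis using assms by simp
    qed
    have "Suc q * (N choose Suc q) = (N - q) * (N choose q)"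
      by (simp only: binomial_absorption binomial_absorb_comp)
    also have "\<dots> \<le> N * (N choose q)" by simp
    finally have "Suc q * (N choose Suc q) \<le> N * (N choose q)" .
    then have "N choose Suc q \<le> N * (N choose q)"
      using le_trans[of "N choose Suc q" "Suc q * (N choose Suc q)"] by simp
    then have le: "real (N choose Suc q) \<le> real N * real (N choose q)"
      by (simp flip: of_nat_mult)
    have "\<beta> / real N * real (N choose Suc q) \<le> \<beta> / real N * (real N * real (N choose q))"
      using assms le by (intro mult_left_mono) auto
    also have "\<dots> = \<beta> * real (N choose q)" using assms by simp
    also have "\<dots> < real (N choose q)" using assms by simp
    finally show ?thesis by (simp add: eps_poly_def flip: s)
  qed
  have "continuous_on {0..1} (eps_poly \<beta> N q)"
    unfolding eps_poly_def by (intro continuous_intros)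
  then obtain t where t: "0 \<le> t" "t \<le> 1" "eps_poly \<beta> N q t = 0"
    using IVT2'[of "eps_poly \<beta> N q" 1 0 0] p0 p1 less_imp_le zero_le_one by blast
  moreover have "t \<noteq> 0" "t \<noteq> 1" using t(3) p0 p1 by fastforce+
  ultimately have "0 < t \<and> t < 1 \<and> eps_poly \<beta> N q t = 0" by linarith
  then show "\<exists>t. 0 < t \<and> t < 1 \<and> eps_poly \<beta> N q t = 0" ..
next
  have less: False if "0 < s" "s < t" "eps_poly \<beta> N q s = 0" "eps_poly \<beta> N q t = 0" for s t
  proof -
    let ?g = "\<lambda>u. \<Sum>m=q..N-1. real (m choose q) * (1 / u) ^ (N - m)"
    have g: "\<beta> / real N * ?g u = real (N choose q)" if "u > 0" "eps_poly \<beta> N q u = 0" for u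
    proof -
      have "(1 / u) ^ (N - m) = u ^ (m - q) / u ^ (N - q)" if "m \<in> {q..N-1}" for m
      proof -
        have "N - q = (m - q) + (N - m)" using that assms by auto
        then show ?thesis using \<open>u > 0\<close> by (simp add: power_add power_divide)
      qed
      then have "?g u = (\<Sum>m=q..N-1. real (m choose q) * u ^ (m - q)) / u ^ (N - q)"
        by (simp add: sum_divide_distrib)
      then have "\<beta> / real N * ?g u =
          \<beta> / real N * (\<Sum>m=q..N-1. real (m choose q) * u ^ (m - q)) / u ^ (N - q)"
        by (simp only: times_divide_eq_right)
      also have "\<dots> = real (N choose q) * u ^ (N - q) / u ^ (N - q)"
        using that(2) by (simp only: eps_poly_def right_minus_eq)
      also have "\<dots> = real (N choose q)" using that(1) by simp
      finally show ?thesis .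
    qed
    have "?g t < ?g s"
    proof (rule sum_strict_mono)
      fix m assume "m \<in> {q..N-1}"
      then show "real (m choose q) * (1 / t) ^ (N - m) < real (m choose q) * (1 / s) ^ (N - m)"
        using that assms
        by (intro mult_strict_left_mono power_strict_mono) (auto simp: field_simps)
    qed (use \<open>q < N\<close> in auto)
    then have "\<beta> / real N * ?g t < \<beta> / real N * ?g s"
      using assms by (intro mult_strict_left_mono) auto
    with g[of s] g[of t] that show False by simp
  qed
  fix s t assume "0 < s \<and> s < 1 \<and> eps_poly \<beta> N q s = 0" "0 < t \<and> t < 1 \<and> eps_poly \<beta> N q t = 0"
  then show "s = t" using less[of s t] less[of t s] by (cases s t rule: linorder_cases) auto
qed

end

theory Submission
  imports Defs
begin

text \<open>
  The bound holds simultaneously for all \<open>y\<close>: with probability at least \<open>1 - \<beta>\<close>, no sampled value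
  \<open>v\<close> satisfies \<open>V v > \<epsilon> (1 + q)\<close>, where \<open>q\<close> is the number of samples above \<open>v\<close>.  This suffices, since
  replacing an arbitrary \<open>y\<close> by the largest sampled value \<open>\<le> y\<close> keeps \<open>q\<close> and does not decrease the risk.

  Consider the largest bad level \<open>v\<close>, and let \<open>t = P (n \<le> v)\<close>, \<open>s = P (n < v)\<close>.  With \<open>m\<close> samples, the
  event that \<open>v\<close> is the largest bad level with exactly \<open>q\<close> samples above it has probability
  \<open>c\<^sub>q * (m choose q) * (t ^ (m - q) - s ^ (m - q))\<close>, where \<open>c\<^sub>q\<close> does not depend on \<open>m\<close>.  Badness says
  that \<open>t\<close> is below the root of \<open>eps_poly \<beta> N (q + 1)\<close>, and integrating the polynomial from \<open>s\<close> to \<open>t\<close>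
  shows that the probability for \<open>N\<close> samples is at most \<open>\<beta> / N\<close> times the sum of those for
  \<open>m = 0, \<dots>, N - 1\<close>.  For each \<open>m\<close> the events are disjoint over \<open>v\<close>, so summing over \<open>v\<close> leaves \<open>\<beta>\<close>.
\<close>

section \<open>Independence in products of discrete distributions\<close>

lemma prob_pair_pmf_Times:
  "measure_pmf.prob (pair_pmf p q) (A \<times> B) = measure_pmf.prob p A * measure_pmf.prob q B"
proof -
  \<comment> \<open>Cutting down to the supports makes both factors countable, as
    \<open>measure_pmf_prob_product\<close> requires.\<close>
  have "(A \<times> B) \<inter> set_pmf (pair_pmf p q) = (A \<inter> set_pmf p) \<times> (B \<inter> set_pmf q)"
    by auto
  then have "measure_pmf.prob (pair_pmf p q) (A \<times> B) =
      measure_pmf.prob (pair_pmf p q) ((A \<inter> set_pmf p) \<times> (B \<inter> set_pmf q))"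
    by (metis measure_Int_set_pmf)
  also have "\<dots> = measure_pmf.prob p (A \<inter> set_pmf p) * measure_pmf.prob q (B \<inter> set_pmf q)"
    by (rule measure_pmf_prob_product) auto
  finally show ?thesis by (simp add: measure_Int_set_pmf)
qed

text \<open>Disjoint blocks of coordinates are independent: by \<open>Pi_pmf_union\<close> the
  product over \<open>S \<union> T\<close> is the image of a pair under \<open>?h\<close>, and each
  predicate sees only one component of that pair.\<close>

lemma prob_Pi_pmf_Un:
  assumes "finite S" "finite T" "S \<inter> T = {}"
    and Q: "\<And>f g. (\<And>i. i \<in> S \<Longrightarrow> f i = g i) \<Longrightarrow> Q f = Q g"
    and Q': "\<And>f g. (\<And>i. i \<in> T \<Longrightarrow> f i = g i) \<Longrightarrow> Q' f = Q' g"
  shows "measure_pmf.prob (Pi_pmf (S \<union> T) d p) {f. Q f \<and> Q' f} =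
    measure_pmf.prob (Pi_pmf S d p) {f. Q f} * measure_pmf.prob (Pi_pmf T d p) {f. Q' f}"
proof -
  let ?h = "\<lambda>(f, g) x. if x \<in> S then f x else g x"
  have 1: "Q (\<lambda>x. if x \<in> S then f x else g x) = Q f" for f g
    by (rule Q) auto
  have 2: "Q' (\<lambda>x. if x \<in> S then f x else g x) = Q' g" for f g
    by (rule Q') (use assms(3) in auto)
  have "?h -` {f. Q f \<and> Q' f} = {f. Q f} \<times> {f. Q' f}"
    using 1 2 by auto
  then show ?thesis
    using assms(1-3) by (simp add: Pi_pmf_union prob_pair_pmf_Times)
qed

section \<open>Bad levels and their decomposition\<close>

definition exceed :: "nat set \<Rightarrow> (nat \<Rightarrow> nat) \<Rightarrow> nat \<Rightarrow> nat" where
  "exceed I a v = card {i \<in> I. v < a i}"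

text \<open>The threshold \<open>e\<close> is not tied to the size of \<open>I\<close>, because
  smaller samples will be tested against the same \<open>eps \<beta> N\<close>.\<close>

definition bad_level :: "(nat \<Rightarrow> real) \<Rightarrow> nat pmf \<Rightarrow> nat set \<Rightarrow> (nat \<Rightarrow> nat) \<Rightarrow> nat \<Rightarrow> bool" where
  "bad_level e D I a v \<longleftrightarrow> v \<in> a ` I \<and> e (Suc (exceed I a v)) < measure_pmf.prob D {v<..}"

definition top_bad_level :: "(nat \<Rightarrow> real) \<Rightarrow> nat pmf \<Rightarrow> nat set \<Rightarrow> (nat \<Rightarrow> nat) \<Rightarrow> nat \<Rightarrow> bool" where
  "top_bad_level e D I a v \<longleftrightarrow> bad_level e D I a v \<and> (\<forall>w>v. \<not> bad_level e D I a w)"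

text \<open>This is what \<open>top_bad_level\<close> demands of the samples above \<open>v\<close>,
  when \<open>S\<close> is their index set. For \<open>S = {..<q}\<close> its probability is the
  factor independent of the sample size.\<close>

definition good_above :: "(nat \<Rightarrow> real) \<Rightarrow> nat pmf \<Rightarrow> nat \<Rightarrow> nat set \<Rightarrow> (nat \<Rightarrow> nat) \<Rightarrow> bool" where
  "good_above e D v S a \<longleftrightarrow> (\<forall>i\<in>S. v < a i) \<and> (\<forall>w>v. \<not> bad_level e D S a w)"

lemma ex_top_bad_level:
  assumes "finite I"
  shows "(\<exists>v. bad_level e D I a v) \<longleftrightarrow> (\<exists>v. top_bad_level e D I a v)"
proof
  assume "\<exists>v. bad_level e D I a v"
  moreover have fin: "finite {v. bad_level e D I a v}"
    using assms by (rule finite_subset[OF _ finite_imageI[of I a], rotated]) (auto simp: bad_level_def)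
  ultimately have "top_bad_level e D I a (Max {v. bad_level e D I a v})"
    unfolding top_bad_level_def using Max_in[OF fin] Max_ge[OF fin] by (auto simp flip: not_le)
  then show "\<exists>v. top_bad_level e D I a v" ..
qed (auto simp: top_bad_level_def)

text \<open>Badness of a level \<open>w > v\<close> is decided by the samples above \<open>v\<close>
  alone. Once their index set \<open>S\<close> is fixed, the event therefore splits into a numerical
  condition, a condition on \<open>S\<close> and one on \<open>I - S\<close>, so that independence
  applies.\<close>

lemma top_bad_level_split:
  assumes "S \<subseteq> I"
  shows "{i \<in> I. v < a i} = S \<and> top_bad_level e D I a v \<longleftrightarrow>
    e (Suc (card S)) < measure_pmf.prob D {v<..} \<and>
    good_above e D v S a \<and> ((\<forall>i\<in>I-S. a i \<le> v) \<and> (\<exists>i\<in>I-S. a i = v))"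
proof (cases "{i \<in> I. v < a i} = S")
  case True
  have iff: "i \<in> S \<longleftrightarrow> i \<in> I \<and> v < a i" for i
    using True by blast
  have set_eq: "{i \<in> I. w < a i} = {i \<in> S. w < a i}" if "w > v" for w
    using that iff less_trans[of v w] by blast
  have image_eq: "w \<in> a ` I \<longleftrightarrow> w \<in> a ` S" if "w > v" for w
    using that iff by blast
  have 1: "bad_level e D I a w \<longleftrightarrow> bad_level e D S a w" if "w > v" for w
    unfolding bad_level_def exceed_def set_eq[OF that] image_eq[OF that] ..
  have 2: "\<forall>i\<in>S. v < a i" "\<forall>i\<in>I-S. a i \<le> v"
    using iff by (blast, metis DiffD1 DiffD2 not_less)
  have 3: "v \<in> a ` I \<longleftrightarrow> (\<exists>i\<in>I-S. a i = v)"
    using iff by force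
  have 4: "bad_level e D I a v \<longleftrightarrow>
      v \<in> a ` I \<and> e (Suc (card S)) < measure_pmf.prob D {v<..}"
    unfolding bad_level_def exceed_def True ..
  show ?thesis
    unfolding top_bad_level_def good_above_def 3 4 using True 1 2 by blast
next
  case False
  have "\<not> ((\<forall>i\<in>S. v < a i) \<and> (\<forall>i\<in>I-S. a i \<le> v))"
  proof
    assume *: "(\<forall>i\<in>S. v < a i) \<and> (\<forall>i\<in>I-S. a i \<le> v)"
    have "{i \<in> I. v < a i} = S"
      using * assms by (auto simp: not_less[symmetric])
    with False show False ..
  qed
  with False show ?thesis
    unfolding good_above_def by blast
qed

lemma good_above_cong:
  assumes "\<And>i. i \<in> S \<Longrightarrow> a i = b i"
  shows "good_above e D v S a = good_above e D v S b"
proof -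
  have "{i \<in> S. w < a i} = {i \<in> S. w < b i}" for w
    by (simp add: assms cong: conj_cong)
  moreover have "a ` S = b ` S"
    by (rule image_cong[OF refl assms])
  moreover have "(\<forall>i\<in>S. v < a i) \<longleftrightarrow> (\<forall>i\<in>S. v < b i)"
    by (rule ball_cong[OF refl]) (simp add: assms)
  ultimately show ?thesis
    unfolding good_above_def bad_level_def exceed_def by presburger
qed

lemma good_above_bij:
  assumes "bij_betw h S T"
  shows "good_above e D v S (a \<circ> h) = good_above e D v T a"
proof -
  have T: "T = h ` S" and inj: "inj_on h S"
    using assms by (auto simp: bij_betw_def)
  have "{i \<in> T. w < a i} = h ` {i \<in> S. w < a (h i)}" for w
    using T by auto
  then have "exceed T a w = exceed S (a \<circ> h) w" for w
    using inj by (simp add: exceed_def card_image inj_on_def)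
  then show ?thesis
    by (auto simp: good_above_def bad_level_def T)
qed

section \<open>The probability that a given level is the top bad one\<close>

lemma prob_good_above_card:
  assumes "finite S"
  shows "measure_pmf.prob (Pi_pmf S 0 (\<lambda>_. D)) {a. good_above e D v S a} =
    measure_pmf.prob (Pi_pmf {..<card S} 0 (\<lambda>_. D)) {a. good_above e D v {..<card S} a}"
proof -
  let ?T = "{..<card S}"
  obtain h0 where h0: "bij_betw h0 ?T S"
    using ex_bij_betw_nat_finite[OF assms] by (auto simp: atLeast0LessThan)
  obtain z where z: "z \<notin> S"
    using assms infinite_UNIV_nat by (metis UNIV_eq_I)
  \<comment> \<open>The samples are identically distributed, so they may be relabelled. Sending all
    other indices to \<open>z\<close>, outside \<open>S\<close>, gives \<open>a \<circ> h\<close>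
    the default value 0 off \<open>?T\<close>.\<close>
  define h where "h x = (if x \<in> ?T then h0 x else z)" for x
  have h: "bij_betw h ?T S"
    using h0 by (rule bij_betw_cong[THEN iffD1, rotated]) (simp add: h_def)
  have "(\<lambda>a. a \<circ> h) -` {a. good_above e D v ?T a} = {a. good_above e D v S a}"
    using good_above_bij[OF h] by auto
  then show ?thesis
    using Pi_pmf_bij_betw[of ?T h S 0 D] h z by (simp add: h_def)
qed

text \<open>The event is a difference of two nested boxes. For empty \<open>T\<close> both sides are
  0.\<close>

lemma prob_all_le_ex_eq:
  fixes D :: "nat pmf"
  assumes "finite T"
  shows "measure_pmf.prob (Pi_pmf T 0 (\<lambda>_. D)) {a. (\<forall>i\<in>T. a i \<le> v) \<and> (\<exists>i\<in>T. a i = v)} =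
    measure_pmf.prob D {..v} ^ card T - measure_pmf.prob D {..<v} ^ card T"
proof -
  let ?P = "Pi_pmf T 0 (\<lambda>_. D)"
  have "{a. (\<forall>i\<in>T. a i \<le> v) \<and> (\<exists>i\<in>T. a i = v)} = Pi T (\<lambda>_. {..v}) - Pi T (\<lambda>_. {..<v})"
    by (auto simp: Pi_iff less_le)
  moreover have "Pi T (\<lambda>_. {..<v}) \<subseteq> Pi T (\<lambda>_. {..v})"
    by (intro Pi_mono) auto
  ultimately show ?thesis
    using assms by (simp add: measure_pmf.finite_measure_Diff measure_Pi_pmf_Pi)
qed

text \<open>The event is partitioned by the set \<open>S\<close> of samples above \<open>v\<close>;
  its conditional shape depends only on \<open>card S\<close>, which produces the binomial
  coefficients. The size of \<open>I\<close> enters only through these and the exponents.\<close>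

lemma prob_top_bad_level:
  assumes "finite I"
  shows "measure_pmf.prob (Pi_pmf I 0 (\<lambda>_. D)) {a. top_bad_level e D I a v} =
    (\<Sum>q\<le>card I. real (card I choose q) *
      (if e (Suc q) < measure_pmf.prob D {v<..}
       then measure_pmf.prob (Pi_pmf {..<q} 0 (\<lambda>_. D)) {a. good_above e D v {..<q} a} *
         (measure_pmf.prob D {..v} ^ (card I - q) - measure_pmf.prob D {..<v} ^ (card I - q))
       else 0))" (is "_ = (\<Sum>q\<le>_. _ * ?w q)")
proof -
  let ?P = "Pi_pmf I 0 (\<lambda>_. D)"
  have S: "measure_pmf.prob ?P {a. {i \<in> I. v < a i} = S \<and> top_bad_level e D I a v} = ?w (card S)"
    if "S \<subseteq> I" for S
  proof (cases "e (Suc (card S)) < measure_pmf.prob D {v<..}")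
    case True
    have fin: "finite S" "finite (I - S)"
      using that assms finite_subset by auto
    have "measure_pmf.prob (Pi_pmf (S \<union> (I - S)) 0 (\<lambda>_. D))
        {a. good_above e D v S a \<and> ((\<forall>i\<in>I-S. a i \<le> v) \<and> (\<exists>i\<in>I-S. a i = v))} =
      measure_pmf.prob (Pi_pmf S 0 (\<lambda>_. D)) {a. good_above e D v S a} *
      measure_pmf.prob (Pi_pmf (I - S) 0 (\<lambda>_. D)) {a. (\<forall>i\<in>I-S. a i \<le> v) \<and> (\<exists>i\<in>I-S. a i = v)}"
      proof (rule prob_Pi_pmf_Un)
      show "good_above e D v S f = good_above e D v S g" if "\<And>i. i \<in> S \<Longrightarrow> f i = g i" for f g
        using that by (rule good_above_cong)
    qed (use fin in auto)
    moreover have "S \<union> (I - S) = I" "card (I - S) = card I - card S"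
      using that fin by (auto simp: card_Diff_subset)
    ultimately show ?thesis
      unfolding top_bad_level_split[OF that]
      using True prob_good_above_card[OF fin(1)] prob_all_le_ex_eq[OF fin(2)] by simp
  next
    case False
    then show ?thesis
      unfolding top_bad_level_split[OF that] by simp
  qed
  have "{a. top_bad_level e D I a v} =
      (\<Union>S\<in>Pow I. {a. {i \<in> I. v < a i} = S \<and> top_bad_level e D I a v})" (is "?L = (\<Union>S\<in>_. ?E S)")
  proof (intro equalityI subsetI)
    fix a assume "a \<in> ?L"
    then have "a \<in> ?E {i \<in> I. v < a i}"
      by simp
    then show "a \<in> (\<Union>S\<in>Pow I. ?E S)"
      by (rule UN_I[rotated]) (simp add: Collect_restrict)
  qed simp
  moreover have "disjoint_family_on ?E (Pow I)"
    by (auto simp: disjoint_family_on_def)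
  ultimately have "measure_pmf.prob ?P {a. top_bad_level e D I a v} =
      (\<Sum>S\<in>Pow I. measure_pmf.prob ?P (?E S))"
    using assms by (simp only:) (rule measure_pmf.finite_measure_finite_Union, auto)
  also have "\<dots> = (\<Sum>S\<in>Pow I. ?w (card S))"
    using S by (intro sum.cong) auto
  also have "\<dots> = (\<Sum>q\<le>card I. \<Sum>S\<in>{S \<in> Pow I. card S = q}. ?w (card S))"
    using assms by (intro sum.group[symmetric]) (auto intro: card_mono)
  also have "\<dots> = (\<Sum>q\<le>card I. real (card I choose q) * ?w q)"
  proof (rule sum.cong)
    fix q
    have "(\<Sum>S\<in>{S \<in> Pow I. card S = q}. ?w (card S)) = (\<Sum>S\<in>{S. S \<subseteq> I \<and> card S = q}. ?w q)"
      by (intro sum.cong) auto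
    then show "(\<Sum>S\<in>{S \<in> Pow I. card S = q}. ?w (card S)) = real (card I choose q) * ?w q"
      using n_subsets[OF assms, of q] by simp
  qed simp
  finally show ?thesis .
qed

section \<open>The polynomial inequality\<close>

lemma eps_poly_nonneg:
  assumes "0 < \<beta>" "\<beta> < 1" "q < N" "0 \<le> s" "s \<le> eps_root \<beta> N q"
  shows "0 \<le> eps_poly \<beta> N q s"
proof (rule ccontr)
  assume neg: "\<not> 0 \<le> eps_poly \<beta> N q s"
  have root: "0 < eps_root \<beta> N q" "eps_root \<beta> N q < 1" "eps_poly \<beta> N q (eps_root \<beta> N q) = 0"
    using theI'[OF eps_poly_ex1[OF assms(1-3)]] by (simp_all add: eps_root_def)
  have "(\<Sum>m=q..N-1. real (m choose q) * 0 ^ (m - q)) = (\<Sum>m=q..N-1. if m = q then 1 else 0)"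
    by (intro sum.cong) (auto simp: power_0_left)
  also have "\<dots> = 1" using \<open>q < N\<close> by simp
  finally have p0: "eps_poly \<beta> N q 0 > 0"
    using assms by (simp add: eps_poly_def power_0_left)
  \<comment> \<open>The polynomial is positive at 0, so a negative value at \<open>s\<close> would
    force a second root in \<open>(0,1)\<close>, below \<open>eps_root\<close>.\<close>
  have "continuous_on {0..s} (eps_poly \<beta> N q)"
    unfolding eps_poly_def by (intro continuous_intros)
  then obtain t where t: "0 \<le> t" "t \<le> s" "eps_poly \<beta> N q t = 0"
    using IVT2'[of "eps_poly \<beta> N q" s 0 0] p0 neg assms(4) by auto
  have "t \<noteq> 0" "t \<noteq> s"
    using t p0 neg by auto
  then have "0 < t \<and> t < 1 \<and> eps_poly \<beta> N q t = 0" "t < eps_root \<beta> N q"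
    using t root assms by auto
  then show False
    using eps_poly_ex1[OF assms(1-3)] root by (metis less_irrefl)
qed

text \<open>The derivative of \<open>\<lambda>t. (m choose q) * t ^ (m - q)\<close> is \<open>Suc q\<close> times the term of
  \<^const>\<open>eps_poly\<close> at \<open>Suc q\<close>, so the inequality is \<open>eps_poly_nonneg\<close> integrated.\<close>

lemma binomial_power_diff_le:
  assumes "0 < \<beta>" "\<beta> < 1" "Suc q < N" "0 \<le> s" "s \<le> t" "t \<le> eps_root \<beta> N (Suc q)"
  shows "real (N choose q) * (t ^ (N - q) - s ^ (N - q)) \<le>
    \<beta> / real N * (\<Sum>m<N. real (m choose q) * (t ^ (m - q) - s ^ (m - q)))"
proof -
  \<comment> \<open>The claim is \<open>G s \<le> G t\<close>.\<close>
  define G where "G u = \<beta> / real N * (\<Sum>m<N. real (m choose q) * u ^ (m - q))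
    - real (N choose q) * u ^ (N - q)" for u
  have coeff: "real (m choose q) * real (m - q) = real (Suc q) * real (m choose Suc q)" for m
    using binomial_absorption[of q m] binomial_absorb_comp[of m q]
    by (metis mult.commute of_nat_mult)
  have term_deriv: "((\<lambda>u. real (m choose q) * u ^ (m - q)) has_real_derivative
      real (Suc q) * (real (m choose Suc q) * u ^ (m - Suc q))) (at u)" for m and u :: real
  proof -
    have "real (m choose q) * (real (m - q) * u ^ (m - q - Suc 0)) =
        real (Suc q) * (real (m choose Suc q) * u ^ (m - Suc q))"
      using coeff[of m] by (simp add: mult.assoc[symmetric] del: of_nat_Suc)
    moreover have "((\<lambda>u. real (m choose q) * u ^ (m - q)) has_real_derivative
        real (m choose q) * (real (m - q) * u ^ (m - q - Suc 0))) (at u)"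
      by (auto intro!: derivative_eq_intros)
    ultimately show ?thesis by (simp only:)
  qed
  have deriv: "(G has_real_derivative real (Suc q) * eps_poly \<beta> N (Suc q) u) (at u)" for u
  proof -
    \<comment> \<open>The terms with \<open>m \<le> q\<close> vanish, so the sum may start at
      \<open>Suc q\<close> as in \<open>eps_poly\<close>.\<close>
    have "(\<Sum>m<N. real (m choose Suc q) * u ^ (m - Suc q)) =
        (\<Sum>m=Suc q..N-1. real (m choose Suc q) * u ^ (m - Suc q))"
      using assms(3) by (intro sum.mono_neutral_right) (auto simp: binomial_eq_0)
    then have "real (Suc q) * eps_poly \<beta> N (Suc q) u =
        \<beta> / real N * (\<Sum>m<N. real (Suc q) * (real (m choose Suc q) * u ^ (m - Suc q)))
        - real (Suc q) * (real (N choose Suc q) * u ^ (N - Suc q))"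
      by (simp add: eps_poly_def algebra_simps flip: sum_distrib_left del: of_nat_Suc)
    moreover have "(G has_real_derivative \<beta> / real N *
        (\<Sum>m<N. real (Suc q) * (real (m choose Suc q) * u ^ (m - Suc q)))
        - real (Suc q) * (real (N choose Suc q) * u ^ (N - Suc q))) (at u)"
      unfolding G_def by (intro DERIV_diff DERIV_cmult DERIV_sum term_deriv)
    ultimately show ?thesis by simp
  qed
  have "G s \<le> G t"
  proof (rule DERIV_nonneg_imp_nondecreasing[OF assms(5)])
    fix u assume "s \<le> u" "u \<le> t"
    then have "0 \<le> real (Suc q) * eps_poly \<beta> N (Suc q) u"
      using assms by (intro mult_nonneg_nonneg eps_poly_nonneg) auto
    with deriv show "\<exists>y. (G has_real_derivative y) (at u) \<and> 0 \<le> y" by blast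
  qed
  then show ?thesis
    by (simp add: G_def right_diff_distrib sum_subtractf)
qed

section \<open>Bounding the probability that a bad level exists\<close>

lemma prob_top_bad_level_le:
  assumes "0 < \<beta>" "\<beta> < 1" "finite I" "card I = N"
  shows "measure_pmf.prob (Pi_pmf I 0 (\<lambda>_. D)) {a. top_bad_level (eps \<beta> N) D I a v} \<le>
    \<beta> / real N * (\<Sum>m<N. measure_pmf.prob (Pi_pmf {..<m} 0 (\<lambda>_. D))
      {a. top_bad_level (eps \<beta> N) D {..<m} a v})"
proof -
  define V where "V = measure_pmf.prob D {v<..}"
  define t where "t = measure_pmf.prob D {..v}"
  define s where "s = measure_pmf.prob D {..<v}"
  define c where "c q = measure_pmf.prob (Pi_pmf {..<q} 0 (\<lambda>_. D))
    {a. good_above (eps \<beta> N) D v {..<q} a}" for q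
  define d where "d q m = real (m choose q) * (t ^ (m - q) - s ^ (m - q))" for q m
  define w where "w q = (if eps \<beta> N (Suc q) < V then c q else 0)" for q
  have P: "measure_pmf.prob (Pi_pmf J 0 (\<lambda>_. D)) {a. top_bad_level (eps \<beta> N) D J a v} =
      (\<Sum>q\<le>N. w q * d q (card J))" if "finite J" "card J \<le> N" for J
  proof -
    \<comment> \<open>Extending the range of \<open>q\<close> to \<open>N\<close> adds only zero
      binomials and gives all sample sizes a common index set.\<close>
    have "(\<Sum>q\<le>card J. w q * d q (card J)) = (\<Sum>q\<le>N. w q * d q (card J))"
      using that by (intro sum.mono_neutral_left) (auto simp: d_def binomial_eq_0)
    moreover have "measure_pmf.prob (Pi_pmf J 0 (\<lambda>_. D)) {a. top_bad_level (eps \<beta> N) D J a v} =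
        (\<Sum>q\<le>card J. w q * d q (card J))"
      unfolding prob_top_bad_level[OF that(1)]
      by (intro sum.cong) (auto simp: w_def V_def c_def d_def t_def s_def)
    ultimately show ?thesis by simp
  qed
  have V: "V = 1 - t"
    using measure_pmf.prob_compl[of "{..v}" D] by (simp add: V_def t_def Compl_eq_Diff_UNIV[symmetric] Compl_atMost)
  have "V \<le> 1" by (simp add: V_def)
  have st: "0 \<le> s" "s \<le> t"
    unfolding s_def t_def by (auto intro: measure_pmf.finite_measure_mono)
  \<comment> \<open>The nonnegative weights \<open>w q\<close> do not depend on the sample size, so
    the comparison can be made for each \<open>q\<close> separately.\<close>
  have "w q * d q N \<le> w q * (\<beta> / real N * (\<Sum>m<N. d q m))" for q
  proof (cases "eps \<beta> N (Suc q) < V")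
    case True
    \<comment> \<open>From index \<open>N\<close> on, \<open>eps\<close> is 1, which no probability
      exceeds.\<close>
    then have "Suc q < N"
      using \<open>V \<le> 1\<close> by (auto simp: eps_def split: if_splits)
    moreover from this True have "t \<le> eps_root \<beta> N (Suc q)"
      using V by (simp add: eps_def)
    ultimately have "d q N \<le> \<beta> / real N * (\<Sum>m<N. d q m)"
      unfolding d_def using assms st by (intro binomial_power_diff_le)
    then show ?thesis
      by (intro mult_left_mono) (auto simp: w_def c_def)
  qed (simp add: w_def)
  then have "(\<Sum>q\<le>N. w q * d q N) \<le> (\<Sum>q\<le>N. w q * (\<beta> / real N * (\<Sum>m<N. d q m)))"
    by (rule sum_mono)
  also have "\<dots> = \<beta> / real N * (\<Sum>q\<le>N. \<Sum>m<N. w q * d q m)"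
    by (simp add: sum_distrib_left mult_ac)
  also have "\<dots> = \<beta> / real N * (\<Sum>m<N. \<Sum>q\<le>N. w q * d q m)"
    by (subst sum.swap) simp
  finally show ?thesis
    using assms P[of I] P[of "{..<_}"] by simp
qed

lemma prob_ex_bad_level_le:
  assumes "0 < \<beta>" "\<beta> < 1" "finite I" "card I = N" "N \<ge> 1"
  shows "measure_pmf.prob (Pi_pmf I 0 (\<lambda>_. D)) {a. \<exists>v. bad_level (eps \<beta> N) D I a v} \<le> \<beta>"
proof -
  define E where "E J v = {a. top_bad_level (eps \<beta> N) D J a v}" for J v
  have disj: "disjoint_family (E J)" for J
    unfolding disjoint_family_on_def E_def top_bad_level_def
    by (auto simp: disjoint_iff) (metis linorder_neqE_nat)
  let ?P = "\<lambda>J. measure_pmf.prob (Pi_pmf J 0 (\<lambda>_. D))"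
  \<comment> \<open>A sample has at most one top bad level.\<close>
  have part: "(\<Sum>v<L. ?P J (E J v)) \<le> 1" for J L
  proof -
    have "(\<Sum>v<L. ?P J (E J v)) = ?P J (\<Union>v<L. E J v)"
      using disj[of J]
      by (intro measure_pmf.finite_measure_finite_Union[symmetric])
        (auto simp: disjoint_family_on_def)
    then show ?thesis by simp
  qed
  \<comment> \<open>Truncating at \<open>L\<close> keeps the exchange of sums finite; the bound then
    passes to the whole series.\<close>
  have "(\<Sum>v<L. ?P I (E I v)) \<le> \<beta>" for L
  proof -
    have "(\<Sum>v<L. ?P I (E I v)) \<le> (\<Sum>v<L. \<beta> / real N * (\<Sum>m<N. ?P {..<m} (E {..<m} v)))"
      unfolding E_def using assms by (intro sum_mono prob_top_bad_level_le)
    also have "\<dots> = \<beta> / real N * (\<Sum>m<N. \<Sum>v<L. ?P {..<m} (E {..<m} v))"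
      by (subst sum.swap) (simp add: sum_distrib_left)
    also have "\<dots> \<le> \<beta> / real N * (\<Sum>m<N. 1)"
      using assms part by (intro mult_left_mono sum_mono) auto
    finally show ?thesis using assms by simp
  qed
  moreover have "(\<lambda>v. ?P I (E I v)) sums ?P I (\<Union>v. E I v)"
    using disj by (intro measure_pmf.finite_measure_UNION) auto
  ultimately have "?P I (\<Union>v. E I v) \<le> \<beta>"
    using suminf_le_const[of "\<lambda>v. ?P I (E I v)" \<beta>] by (auto simp: sums_iff)
  moreover have "(\<Union>v. E I v) = {a. \<exists>v. bad_level (eps \<beta> N) D I a v}"
    using ex_top_bad_level[OF assms(3)] by (auto simp: E_def)
  ultimately show ?thesis by simp
qed


section \<open>Passing between the sample space and the distribution of the counts\<close>

lemma risk_le_eps: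
  assumes "prob_space M" and meas: "n \<in> measurable M (count_space UNIV)"
    and D: "measure_pmf D = distr M (count_space UNIV) n"
    and good: "\<And>v. \<not> bad_level (eps \<beta> N) D {1..N} a v"
  shows "risk M n y \<le> eps \<beta> N (1 + card {i \<in> {1..N}. real (a i) > y})"
proof (cases "{i \<in> {1..N}. real (a i) > y} = {1..N}")
  \<comment> \<open>No sampled value lies below \<open>y\<close> here, but the index is
    \<open>N + 1\<close>, where \<open>eps\<close> is 1.\<close>
  case True
  interpret prob_space M by fact
  show ?thesis
    unfolding True by (simp add: risk_def eps_def)
next
  case False
  interpret prob_space M by fact
  \<comment> \<open>No sample lies in the interval from \<open>w\<close> (exclusive) to
    \<open>y\<close>, so both have the same exceedances, while the risk at \<open>w\<close> is at
    least that at \<open>y\<close>.\<close>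
  define w where "w = Max (a ` {i \<in> {1..N}. real (a i) \<le> y})"
  have "w \<in> a ` {i \<in> {1..N}. real (a i) \<le> y}"
    unfolding w_def using False by (intro Max_in) (auto simp: not_less)
  then have w: "w \<in> a ` {1..N}" "real w \<le> y"
    by auto
  have "a i \<le> w" if "i \<in> {1..N}" "real (a i) \<le> y" for i
    unfolding w_def using that by (intro Max_ge) auto
  then have "{i \<in> {1..N}. real (a i) > y} = {i \<in> {1..N}. w < a i}"
    using w(2) by (auto simp: not_less[symmetric])
  then have "measure_pmf.prob D {w<..} \<le> eps \<beta> N (1 + card {i \<in> {1..N}. real (a i) > y})"
    using good[of w] w(1) by (simp add: bad_level_def exceed_def)
  moreover have "risk M n y \<le> measure M (n -` {w<..} \<inter> space M)"
    unfolding risk_def using w(2) meas by (intro finite_measure_mono measurable_sets[OF meas]) auto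
  moreover have "measure M (n -` {w<..} \<inter> space M) = measure_pmf.prob D {w<..}"
    using meas by (simp add: D measure_distr)
  ultimately show ?thesis by linarith
qed

text \<open>On a countable type the distribution is carried by its atoms. As a pmf it makes every
  event measurable.\<close>

lemma ex_pmf_distr_countable:
  fixes f :: "'a \<Rightarrow> 'b::countable"
  assumes "prob_space M" and meas: "f \<in> measurable M (count_space UNIV)"
  shows "\<exists>p. measure_pmf p = distr M (count_space UNIV) f"
proof -
  interpret P: prob_space "distr M (count_space UNIV) f"
    by (rule prob_space.prob_space_distr) fact+
  have "AE x in distr M (count_space UNIV) f. measure (distr M (count_space UNIV) f) {x} \<noteq> 0"
    by (subst P.AE_support_countable) (auto intro!: exI[of _ UNIV])
  then have "measure_pmf (Abs_pmf (distr M (count_space UNIV) f)) = distr M (count_space UNIV) f"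
    by (intro Abs_pmf_inverse) (auto intro: P.prob_space_axioms)
  then show ?thesis ..
qed

text \<open>The map takes values in a countable set \<open>C\<close>, so measurability and equality
  of the two measures can both be checked on single points, whose preimages are boxes.\<close>

lemma
  fixes n :: "'a \<Rightarrow> 'b::countable"
  assumes "prob_space M" and meas: "n \<in> measurable M (count_space UNIV)"
    and D: "measure_pmf D = distr M (count_space UNIV) n" and fin: "finite I"
  shows measurable_PiM_discrete: "(\<lambda>x i. if i \<in> I then n (x i) else d) \<in>
      measurable (Pi\<^sub>M I (\<lambda>_. M)) (count_space UNIV)" (is "?g \<in> _")
    and distr_PiM_discrete: "distr (Pi\<^sub>M I (\<lambda>_. M)) (count_space UNIV)
      (\<lambda>x i. if i \<in> I then n (x i) else d) = measure_pmf (Pi_pmf I d (\<lambda>_. D))"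
proof -
  interpret prob_space M by fact
  interpret product_prob_space "\<lambda>_. M" I by standard
  let ?M = "Pi\<^sub>M I (\<lambda>_. M)"
  define C where "C = PiE_dflt I d (\<lambda>_. UNIV :: 'b set)"
  have "C = (\<lambda>h x. if x \<in> I then h x else d) ` PiE I (\<lambda>_. UNIV)"
    unfolding C_def by (rule dflt_image_PiE[symmetric])
  then have C: "countable C"
    using fin by (auto intro!: countable_image countable_PiE)
  have gC: "?g x \<in> C" for x
    by (simp add: C_def PiE_dflt_def)
  have atom: "?g -` {a} \<inter> space ?M = PiE I (\<lambda>i. n -` {a i} \<inter> space M)" if "a \<in> C" for a
  proof -
    have "?g x = a \<longleftrightarrow> (\<forall>i\<in>I. n (x i) = a i)" for x
      using that by (auto simp: C_def PiE_dflt_def fun_eq_iff)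
    then show ?thesis
      by (auto simp: space_PiM PiE_iff)
  qed
  have atom_sets: "?g -` {a} \<inter> space ?M \<in> sets ?M" if "a \<in> C" for a
    unfolding atom[OF that] using fin by (intro sets_PiM_I_finite) (auto intro: measurable_sets[OF meas])
  show g: "?g \<in> measurable ?M (count_space UNIV)"
  proof (rule measurableI)
    fix A :: "('c \<Rightarrow> 'b) set"
    have "?g -` A \<inter> space ?M = (\<Union>a\<in>A \<inter> C. ?g -` {a} \<inter> space ?M)"
      using gC by auto
    then show "?g -` A \<inter> space ?M \<in> sets ?M"
      using C atom_sets by (simp only:) (intro sets.countable_UN'; blast intro: countable_Int2)
  qed simp
  show "distr ?M (count_space UNIV) ?g = measure_pmf (Pi_pmf I d (\<lambda>_. D))"
  proof (rule measure_eqI_countable_AE[where \<Omega> = C])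
    show "AE a in distr ?M (count_space UNIV) ?g. a \<in> C"
      using g gC by (subst AE_distr_iff) auto
    show "AE a in measure_pmf (Pi_pmf I d (\<lambda>_. D)). a \<in> C"
      using set_Pi_pmf_subset[OF fin] by (force simp: AE_measure_pmf_iff C_def PiE_dflt_def)
    fix a assume a: "a \<in> C"
    have "emeasure (distr ?M (count_space UNIV) ?g) {a} = (\<Prod>i\<in>I. emeasure M (n -` {a i} \<inter> space M))"
      using g fin by (simp add: emeasure_distr atom[OF a] emeasure_PiM measurable_sets[OF meas])
    also have "\<dots> = (\<Prod>i\<in>I. emeasure (measure_pmf D) {a i})"
      using meas by (simp add: D emeasure_distr)
    also have "\<dots> = ennreal (\<Prod>i\<in>I. pmf D (a i))"
      by (simp add: emeasure_pmf_single prod_ennreal)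
    also have "\<dots> = emeasure (measure_pmf (Pi_pmf I d (\<lambda>_. D))) {a}"
      using a fin by (simp add: emeasure_pmf_single pmf_Pi C_def PiE_dflt_def)
    finally show "emeasure (distr ?M (count_space UNIV) ?g) {a} =
      emeasure (measure_pmf (Pi_pmf I d (\<lambda>_. D))) {a}" .
  qed (use C in auto)
qed

section \<open>Optimal solutions of the relaxed program\<close>

lemma feasible_cong:
  assumes "\<And>i. i \<in> {1..N} \<Longrightarrow> a i = b i"
  shows "feasible N a = feasible N b"
proof (intro ext)
  fix y \<xi>
  show "feasible N a y \<xi> = feasible N b y \<xi>"
    using assms unfolding feasible_def by metis
qed

text \<open>As \<open>\<rho> > 0\<close>, any slack above the least feasible one raises the cost
  strictly. Hence the positive slacks are exactly the samples above \<open>y\<close>.\<close>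

lemma optimal_slack:
  assumes opt: "optimal \<rho> N a y \<xi>" and "\<rho> > 0" and i: "i \<in> {1..N}"
  shows "\<xi> i = max 0 (a i - y)"
proof (rule ccontr)
  assume ne: "\<xi> i \<noteq> max 0 (a i - y)"
  have feas: "feasible N a y \<xi>"
    using opt by (simp add: optimal_def)
  then have le: "max 0 (a j - y) \<le> \<xi> j" if "j \<in> {1..N}" for j
    using that by (force simp: feasible_def)
  have "(\<Sum>j=1..N. max 0 (a j - y)) < (\<Sum>j=1..N. \<xi> j)"
    using i le ne by (intro sum_strict_mono_ex1) (auto intro!: bexI[of _ i] simp: less_le)
  then have "relaxed_cost \<rho> N y (\<lambda>j. max 0 (a j - y)) < relaxed_cost \<rho> N y \<xi>"
    using \<open>\<rho> > 0\<close> by (simp add: relaxed_cost_def)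
  moreover have "feasible N a y (\<lambda>j. max 0 (a j - y))"
    using feas by (auto simp: feasible_def)
  ultimately show False
    using opt by (force simp: optimal_def)
qed

text \<open>Equal data give the same optimal solutions, so each selected value is ranked at least as
  high as the other, and antisymmetry identifies them.\<close>

lemma selected_solution_unique:
  assumes "antisym R"
    and sel: "selected_solution R \<rho> N a y \<xi>" "selected_solution R \<rho> N b y' \<xi>'"
    and eq: "\<And>i. i \<in> {1..N} \<Longrightarrow> a i = b i"
  shows "y = y'"
proof -
  have "optimal \<rho> N a = optimal \<rho> N b"
    using feasible_cong[OF eq] by (simp add: optimal_def fun_eq_iff)
  then have "(y, y') \<in> R" "(y', y) \<in> R"
    using sel by (auto simp: selected_solution_def)
  then show ?thesis
    using \<open>antisym R\<close> by (auto dest: antisymD)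
qed

theorem theorem2:
  fixes M :: "'a measure" and n :: "'a \<Rightarrow> nat" and N :: nat and \<rho> \<beta> :: real
    and R :: "(real \<times> real) set"
    and y_star :: "(nat \<Rightarrow> 'a) \<Rightarrow> real" and xi_star :: "(nat \<Rightarrow> 'a) \<Rightarrow> nat \<Rightarrow> real"
  assumes "prob_space M"
    and "n \<in> measurable M (count_space UNIV)"
    and "N \<ge> 1" and "\<rho> > 0" and "0 < \<beta>" and "\<beta> < 1"
    and "linear_order_on {0..} R"
    and "\<And>x. x \<in> space (Pi\<^sub>M {1..N} (\<lambda>_. M)) \<Longrightarrow>
           selected_solution R \<rho> N (\<lambda>i. real (n (x i))) (y_star x) (xi_star x)"
  shows "measure (Pi\<^sub>M {1..N} (\<lambda>_. M))
           {x \<in> space (Pi\<^sub>M {1..N} (\<lambda>_. M)).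
              risk M n (y_star x) \<le> eps \<beta> N (1 + card {i \<in> {1..N}. xi_star x i > 0})}
         \<ge> 1 - \<beta>"
proof -
  let ?I = "{1..N}" and ?M = "Pi\<^sub>M {1..N} (\<lambda>_. M)"
  let ?\<Phi> = "\<lambda>x y. risk M n y \<le> eps \<beta> N (1 + card {i \<in> ?I. real (n (x i)) > y})"
  define g where "g x i = (if i \<in> ?I then n (x i) else 0)" for x i
  define X where "X = {x \<in> space ?M. ?\<Phi> x (y_star x)}"
  interpret P: prob_space ?M
    using assms(1) by (intro prob_space_PiM)
  obtain D where D: "measure_pmf D = distr M (count_space UNIV) n"
    using ex_pmf_distr_countable[OF assms(1,2)] by blast
  have g: "g \<in> measurable ?M (count_space UNIV)"
    and distr_g: "distr ?M (count_space UNIV) g = measure_pmf (Pi_pmf ?I 0 (\<lambda>_. D))"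
    unfolding g_def[abs_def]
    using measurable_PiM_discrete[OF assms(1,2) D finite_atLeastAtMost]
      distr_PiM_discrete[OF assms(1,2) D finite_atLeastAtMost] by auto
  let ?B = "{a. \<exists>v. bad_level (eps \<beta> N) D ?I a v}"
  have slack: "{i \<in> ?I. xi_star x i > 0} = {i \<in> ?I. real (n (x i)) > y_star x}"
    if "x \<in> space ?M" for x
    using optimal_slack[of \<rho> N "\<lambda>i. real (n (x i))" "y_star x" "xi_star x"] assms(4) assms(8)[OF that]
    by (auto simp: selected_solution_def)
  have g_eq: "n (x i) = n (x' i)" if "g x = g x'" "i \<in> ?I" for x x' i
    using fun_cong[OF that(1), of i] that(2) by (simp add: g_def)
  text \<open>The event depends on the sample only through the counts \<open>n (x i)\<close>; this makes it
    measurable although \<^term>\<open>y_star\<close> is not assumed to be.\<close>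
  have "X = g -` (g ` X) \<inter> space ?M"
  proof (rule equalityI[OF _ subsetI])
    fix x assume "x \<in> g -` (g ` X) \<inter> space ?M"
    then obtain x' where x: "x \<in> space ?M" and x': "x' \<in> X" and eq: "g x = g x'"
      by auto
    have n: "n (x i) = n (x' i)" if "i \<in> ?I" for i
      using g_eq[OF eq that] .
    have "y_star x = y_star x'"
    proof (rule selected_solution_unique)
      show "antisym R"
        using assms(7) by (simp add: order_on_defs)
      show "selected_solution R \<rho> N (\<lambda>i. real (n (x i))) (y_star x) (xi_star x)"
        using x by (rule assms(8))
      show "selected_solution R \<rho> N (\<lambda>i. real (n (x' i))) (y_star x') (xi_star x')"
        using x' by (intro assms(8)) (simp add: X_def)
      show "real (n (x i)) = real (n (x' i))" if "i \<in> ?I" for i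
        using n[OF that] by simp
    qed
    moreover have "{i \<in> ?I. real (n (x i)) > y} = {i \<in> ?I. real (n (x' i)) > y}" for y
      using n by (intro Collect_cong conj_cong) auto
    ultimately show "x \<in> X"
      using x x' by (simp add: X_def)
  qed (auto simp: X_def)
  then have X: "X \<in> sets ?M"
    using measurable_sets[OF g, of "g ` X"] by simp
  \<comment> \<open>Without bad levels the bound holds for every \<open>y\<close>, in particular for
    \<open>y_star x\<close>.\<close>
  have "g -` (- ?B) \<inter> space ?M \<subseteq> X"
  proof
    fix x assume x: "x \<in> g -` (- ?B) \<inter> space ?M"
    have "{i \<in> ?I. real (g x i) > y_star x} = {i \<in> ?I. real (n (x i)) > y_star x}"
      by (auto simp: g_def)
    then show "x \<in> X"
      using risk_le_eps[OF assms(1,2) D, of \<beta> N "g x" "y_star x"] x by (simp add: X_def)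
  qed
  then have "P.prob (g -` (- ?B) \<inter> space ?M) \<le> P.prob X"
    using X by (rule P.finite_measure_mono)
  moreover have "P.prob (g -` (- ?B) \<inter> space ?M) = measure_pmf.prob (Pi_pmf ?I 0 (\<lambda>_. D)) (- ?B)"
    unfolding distr_g[symmetric] using g by (intro measure_distr[symmetric]) auto
  moreover have "\<dots> = 1 - measure_pmf.prob (Pi_pmf ?I 0 (\<lambda>_. D)) ?B"
    using measure_pmf.prob_compl[of ?B] by (simp add: Compl_eq_Diff_UNIV)
  moreover have "measure_pmf.prob (Pi_pmf ?I 0 (\<lambda>_. D)) ?B \<le> \<beta>"
    using assms by (intro prob_ex_bad_level_le) auto
  moreover have "X = {x \<in> space ?M.
      risk M n (y_star x) \<le> eps \<beta> N (1 + card {i \<in> ?I. xi_star x i > 0})}"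
    unfolding X_def using slack by auto
  ultimately show ?thesis by simp
qed

end
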